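(* Let $n,m$ be natural numbers and let $P(x_{1},\dots,x_{n})$ and $Q(y_{1},\dots,y_{m})$ be homogeneous polynomials with integer coefficients, with constant term $0$, whose variables are exactly $x_{1},\dots,x_{n}$ and exactly $y_{1},\dots,y_{m}$ respectively, and which are both partition regular on $\mathbb{N}$. Suppose moreover that $\{x_{1},\dots,x_{n}\}\cap\{y_{1},\dots,y_{m}\}=\emptyset$. Then the polynomial $P(x_{1},\dots,x_{n})+Q(y_{1},\dots,y_{m})$ (in the $n+m$ variables $x_{1},\dots,x_{n},y_{1},\dots,y_{m}$) is partition regular on $\mathbb{N}$.
   Context: Here $\mathbb{N}=\{1,2,3,\dots\}$. A polynomial $R(t_{1},\dots,t_{s})$ with integer coefficients is partition regular on $\mathbb{N}$ if, for every finite coloration $\mathbb{N}=A_{1}\cup\dots\cup A_{r}$ of $\mathbb{N}$, the equation $R(t_{1},\dots,t_{s})=0$ has a monochromatic solution, i.e. there are an index $j\leq r$ and elements $a_{1},\dots,a_{s}\in A_{j}$ (not required to be distinct) with $R(a_{1},\dots,a_{s})=0$. The polynomials $P$ and $Q$ are not assumed to have the same degree. *)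

theory Defs
  imports "HOL-Library.Poly_Mapping"
begin

text \<open>
  Polynomials with integer coefficients in variables from a type \<open>'v\<close>, as finitely supported
  maps from monomials (finitely supported exponent vectors) to coefficients; the ring operations
  of \<^theory>\<open>HOL-Library.Poly_Mapping\<close> are then the usual ones on polynomials.
\<close>

type_synonym 'v int_mpoly = "('v \<Rightarrow>\<^sub>0 nat) \<Rightarrow>\<^sub>0 int"

definition poly_vars :: "'v int_mpoly \<Rightarrow> 'v set" where
  "poly_vars R = (\<Union>\<mu>\<in>Poly_Mapping.keys R. Poly_Mapping.keys \<mu>)"

definition monom_degree :: "('v \<Rightarrow>\<^sub>0 nat) \<Rightarrow> nat" where
  "monom_degree \<mu> = (\<Sum>v\<in>Poly_Mapping.keys \<mu>. Poly_Mapping.lookup \<mu> v)"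

definition homogeneous :: "'v int_mpoly \<Rightarrow> bool" where
  "homogeneous R \<longleftrightarrow> (\<exists>d. \<forall>\<mu>\<in>Poly_Mapping.keys R. monom_degree \<mu> = d)"

definition constant_term :: "'v int_mpoly \<Rightarrow> int" where
  "constant_term R = Poly_Mapping.lookup R 0"

definition poly_eval :: "'v int_mpoly \<Rightarrow> ('v \<Rightarrow> int) \<Rightarrow> int" where
  "poly_eval R a = (\<Sum>\<mu>\<in>Poly_Mapping.keys R.
     Poly_Mapping.lookup R \<mu> * (\<Prod>v\<in>Poly_Mapping.keys \<mu>. a v ^ Poly_Mapping.lookup \<mu> v))"

text \<open>
  The positive integers are \<open>{1..}\<close>. The set \<open>V\<close> is the set of variables
  \<open>t\<^sub>1, \<dots>, t\<^sub>s\<close> in which the equation is considered; it is meant to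
  contain \<open>poly_vars R\<close>, and values of \<open>a\<close> outside \<open>V\<close> are then irrelevant.
  A coloration is a finite cover, and its classes are not required to be disjoint or nonempty.
\<close>

definition partition_regular :: "'v set \<Rightarrow> 'v int_mpoly \<Rightarrow> bool" where
  "partition_regular V R \<longleftrightarrow>
     (\<forall>(r::nat) (A :: nat \<Rightarrow> nat set). (\<Union>j\<in>{1..r}. A j) = {1..} \<longrightarrow>
        (\<exists>j\<in>{1..r}. \<exists>a :: 'v \<Rightarrow> nat.
           (\<forall>v\<in>V. a v \<in> A j) \<and> poly_eval R (\<lambda>v. int (a v)) = 0))"

end

theory Submission imports Defs begin

text \<open>
  Solutions of a homogeneous equation may be rescaled, so it suffices to find one colour class
  containing both a root of \<open>P\<close> and a root of \<open>Q\<close>. By compactness some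
  \<open>N\<close> is such that every colouring of \<open>{1..N}\<close> with the given colours has a
  monochromatic root of \<open>P\<close>. Colour \<open>k\<close> by the vector of colours of
  \<open>k, 2k, \<dots>, Nk\<close> and take a monochromatic root \<open>b\<close> of \<open>Q\<close> for this
  product colouring: the colour of \<open>i b\<^sub>l\<close> then depends on \<open>i \<le> N\<close> only. A
  root \<open>a\<close> of \<open>P\<close> in \<open>{1..N}\<close> that is monochromatic for the colouring of
  the \<open>i\<close> makes all products \<open>a\<^sub>k b\<^sub>l\<close> have the same colour, and
  \<open>b\<^sub>1 a\<close> and \<open>a\<^sub>1 b\<close> are the desired roots.
\<close>

lemma poly_eval_superset:
  assumes "finite K" "Poly_Mapping.keys R \<subseteq> K"
  shows "poly_eval R a = (\<Sum>\<mu>\<in>K.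
     Poly_Mapping.lookup R \<mu> * (\<Prod>v\<in>Poly_Mapping.keys \<mu>. a v ^ Poly_Mapping.lookup \<mu> v))"
  unfolding poly_eval_def
  by (rule sum.mono_neutral_left) (use assms in \<open>auto simp: in_keys_iff\<close>)

lemma poly_eval_add: "poly_eval (P + Q) a = poly_eval P a + poly_eval Q a"
proof -
  let ?K = "Poly_Mapping.keys P \<union> Poly_Mapping.keys Q"
  have K: "finite ?K" "Poly_Mapping.keys P \<subseteq> ?K" "Poly_Mapping.keys Q \<subseteq> ?K"
    "Poly_Mapping.keys (P + Q) \<subseteq> ?K"
    using Poly_Mapping.keys_add[of P Q] by auto
  show ?thesis
    unfolding poly_eval_superset[OF K(1,2)] poly_eval_superset[OF K(1,3)]
      poly_eval_superset[OF K(1,4)]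
    by (simp add: lookup_add distrib_right sum.distrib)
qed

lemma poly_eval_cong:
  assumes "\<And>v. v \<in> poly_vars R \<Longrightarrow> a v = b v"
  shows "poly_eval R a = poly_eval R b"
proof -
  have "(\<Prod>v\<in>Poly_Mapping.keys \<mu>. a v ^ Poly_Mapping.lookup \<mu> v) =
        (\<Prod>v\<in>Poly_Mapping.keys \<mu>. b v ^ Poly_Mapping.lookup \<mu> v)"
    if "\<mu> \<in> Poly_Mapping.keys R" for \<mu>
  proof (rule prod.cong[OF refl])
    fix v assume "v \<in> Poly_Mapping.keys \<mu>"
    then have "v \<in> poly_vars R" using that by (auto simp: poly_vars_def)
    then show "a v ^ Poly_Mapping.lookup \<mu> v = b v ^ Poly_Mapping.lookup \<mu> v"
      by (simp add: assms)
  qed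
  then show ?thesis
    unfolding poly_eval_def by simp
qed

text \<open>Every monomial picks up the same factor \<open>t ^ d\<close>, so roots stay roots under
  rescaling.\<close>

lemma homogeneous_poly_eval_scale_eq_0:
  assumes "homogeneous R" "poly_eval R a = 0"
  shows "poly_eval R (\<lambda>v. t * a v) = 0"
proof -
  obtain d where d: "\<And>\<mu>. \<mu> \<in> Poly_Mapping.keys R \<Longrightarrow> monom_degree \<mu> = d"
    using assms(1) unfolding homogeneous_def by blast
  have "poly_eval R (\<lambda>v. t * a v) = t ^ d * poly_eval R a"
    unfolding poly_eval_def sum_distrib_left
  proof (rule sum.cong[OF refl])
    fix \<mu> assume "\<mu> \<in> Poly_Mapping.keys R"
    then have "(\<Prod>v\<in>Poly_Mapping.keys \<mu>. t ^ Poly_Mapping.lookup \<mu> v) = t ^ d"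
      using d[of \<mu>] by (simp add: monom_degree_def flip: power_sum)
    then show "Poly_Mapping.lookup R \<mu> *
        (\<Prod>v\<in>Poly_Mapping.keys \<mu>. (t * a v) ^ Poly_Mapping.lookup \<mu> v) =
      t ^ d * (Poly_Mapping.lookup R \<mu> *
        (\<Prod>v\<in>Poly_Mapping.keys \<mu>. a v ^ Poly_Mapping.lookup \<mu> v))"
      by (simp add: power_mult_distrib prod.distrib)
  qed
  then show ?thesis using assms(2) by simp
qed

text \<open>Passes from indexed covers to colourings in an arbitrary type with finite range on the
  positive integers, so that lists of colours can later serve as colours.\<close>

lemma partition_regular_colouring:
  fixes c :: "nat \<Rightarrow> 'c"
  assumes "partition_regular V R" "finite (c ` {1..})"
  obtains a j where "\<forall>v\<in>V. a v \<ge> 1 \<and> c (a v) = j"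
    "poly_eval R (\<lambda>v. int (a v)) = 0"
proof -
  obtain h where h: "bij_betw h {1..card (c ` {1..})} (c ` {1..})"
    using ex_bij_betw_nat_finite_1[OF assms(2)] by blast
  define A where "A j = {k. k \<ge> 1 \<and> c k = h j}" for j
  have "(\<Union>j\<in>{1..card (c ` {1..})}. A j) = {1..}"
  proof (intro set_eqI iffI)
    fix k :: nat assume "k \<in> {1..}"
    then have "c k \<in> h ` {1..card (c ` {1..})}"
      using h by (simp add: bij_betw_def)
    then show "k \<in> (\<Union>j\<in>{1..card (c ` {1..})}. A j)"
      using \<open>k \<in> {1..}\<close> unfolding A_def by auto
  qed (auto simp: A_def)
  then obtain j a where "\<forall>v\<in>V. a v \<in> A j" "poly_eval R (\<lambda>v. int (a v)) = 0"
    using assms(1) unfolding partition_regular_def by blast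
  then show thesis
    using that[of a "h j"] by (auto simp: A_def)
qed

text \<open>If every \<open>N\<close> had a bad colouring \<open>c N\<close>, a diagonal argument
  would give a limit colouring \<open>d\<close>. A monochromatic root for \<open>d\<close> is
  bounded, and some \<open>c N\<close> with \<open>N\<close> large agrees with \<open>d\<close> up
  to that bound.\<close>

lemma partition_regular_compactness:
  fixes C :: "'c set"
  assumes R: "partition_regular V R" and "finite V" and "finite C"
  shows "\<exists>N. \<forall>c. c ` {1..} \<subseteq> C \<longrightarrow>
    (\<exists>a j. (\<forall>v\<in>V. a v \<in> {1..N} \<and> c (a v) = j) \<and> poly_eval R (\<lambda>v. int (a v)) = 0)"
proof (rule ccontr)
  define good where "good c N \<longleftrightarrow>
    (\<exists>a j. (\<forall>v\<in>V. a v \<in> {1..N} \<and> c (a v) = j) \<and> poly_eval R (\<lambda>v. int (a v)) = 0)"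
    for c :: "nat \<Rightarrow> 'c" and N
  assume "\<not> ?thesis"
  then have "\<forall>N. \<exists>c. c ` {1..} \<subseteq> C \<and> \<not> good c N"
    unfolding good_def[symmetric] by simp
  from choice[OF this] obtain c
    where c: "\<forall>N. c N ` {1..} \<subseteq> C \<and> \<not> good (c N) N" ..
  then have cC: "c N k \<in> C" if "k \<ge> 1" for N k
    using that by (auto simp: image_subset_iff)
  \<comment> \<open>Along the numbers \<open>N\<close> of \<open>S k\<close> the colourings \<open>c N\<close> agree on \<open>{1..k}\<close>.\<close>
  have "\<exists>S. \<forall>k. infinite (S k) \<and>
    (S (Suc k) \<subseteq> S k \<and> (\<exists>j. \<forall>N\<in>S (Suc k). c N (Suc k) = j))"
  proof (rule dependent_nat_choice)
    show "\<exists>S :: nat set. infinite S" by (rule exI[of _ UNIV]) simp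
  next
    fix S :: "nat set" and k assume "infinite S"
    have "finite ((\<lambda>N. c N (Suc k)) ` S)"
      by (rule finite_subset[OF _ \<open>finite C\<close>]) (use cC in auto)
    then obtain N0 where "infinite {N \<in> S. c N (Suc k) = c N0 (Suc k)}"
      using pigeonhole_infinite[OF \<open>infinite S\<close>] by blast
    then show "\<exists>T. infinite T \<and> (T \<subseteq> S \<and> (\<exists>j. \<forall>N\<in>T. c N (Suc k) = j))"
      by (intro exI[of _ "{N \<in> S. c N (Suc k) = c N0 (Suc k)}"]) auto
  qed
  then obtain S where "\<forall>k. infinite (S k) \<and>
    (S (Suc k) \<subseteq> S k \<and> (\<exists>j. \<forall>N\<in>S (Suc k). c N (Suc k) = j))" ..
  then have S: "infinite (S k)"
    and step: "S (Suc k) \<subseteq> S k \<and> (\<exists>j. \<forall>N\<in>S (Suc k). c N (Suc k) = j)" for k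
    by simp_all
  have "\<forall>k. \<exists>j. \<forall>N\<in>S (Suc k). c N (Suc k) = j"
    using step by blast
  from choice[OF this] obtain f
    where f: "\<forall>k. \<forall>N\<in>S (Suc k). c N (Suc k) = f k" ..
  \<comment> \<open>\<open>f k\<close> is the eventual colour of \<open>Suc k\<close>, hence the
    shift; only positive arguments of \<open>d\<close> matter.\<close>
  define d where "d k = f (k - 1)" for k
  have anti: "S l \<subseteq> S k" if "k \<le> l" for k l
    using lift_Suc_antimono_le[of S, OF _ that] step by blast
  have agree: "c N k = d k" if "N \<in> S K" "k \<in> {1..K}" for N k K
    using f[THEN spec, of "k - 1"] anti[of k K] that by (auto simp: d_def)
  have "d ` {1..} \<subseteq> C"
  proof
    fix z assume "z \<in> d ` {1..}"
    then obtain k where k: "k \<ge> 1" "z = d k" by auto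
    obtain N where "N \<in> S k" using infinite_imp_nonempty[OF S] by blast
    then show "z \<in> C" using agree[of N k k] cC[of k N] k by auto
  qed
  then have "finite (d ` {1..})" using \<open>finite C\<close> finite_subset by blast
  then obtain a j where a: "\<forall>v\<in>V. a v \<ge> 1 \<and> d (a v) = j"
    and root: "poly_eval R (\<lambda>v. int (a v)) = 0"
    by (rule partition_regular_colouring[OF R])
  \<comment> \<open>The sum is a crude upper bound for all the values \<open>a v\<close>.\<close>
  define K where "K = (\<Sum>v\<in>V. a v)"
  have K: "a v \<in> {1..K}" if "v \<in> V" for v
    using a member_le_sum[of v V a] that \<open>finite V\<close> by (simp add: K_def)
  obtain N where N: "N \<in> S K" "N \<ge> K"
    using S[of K] finite_subset[of "S K" "{..<K}"] by (meson finite_lessThan lessThan_iff not_le subsetI)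
  have "\<forall>v\<in>V. a v \<in> {1..N} \<and> c N (a v) = j"
  proof
    fix v assume v: "v \<in> V"
    have "c N (a v) = d (a v)" by (rule agree[OF N(1) K[OF v]])
    then show "a v \<in> {1..N} \<and> c N (a v) = j"
      using v a K[OF v] N(2) by auto
  qed
  then have "good (c N) N"
    unfolding good_def using root by (intro exI[of _ a] exI[of _ j] conjI)
  then show False using c by simp
qed

text \<open>Compactness is applied to \<open>P\<close>, whence the finiteness of \<open>V\<close>;
  the product colouring is applied to \<open>Q\<close>.\<close>

lemma common_colour_solutions:
  fixes c :: "nat \<Rightarrow> 'c" and P Q :: "'v int_mpoly"
  assumes P: "partition_regular V P" "homogeneous P" "finite V" "V \<noteq> {}"
    and Q: "partition_regular W Q" "homogeneous Q" "W \<noteq> {}"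
    and c: "finite (c ` {1..})"
  obtains a b j where "\<forall>v\<in>V. a v \<ge> 1 \<and> c (a v) = j"
    "\<forall>w\<in>W. b w \<ge> 1 \<and> c (b w) = j"
    "poly_eval P (\<lambda>v. int (a v)) = 0" "poly_eval Q (\<lambda>w. int (b w)) = 0"
proof -
  obtain N where N: "\<forall>d. d ` {1..} \<subseteq> c ` {1..} \<longrightarrow>
    (\<exists>a j. (\<forall>v\<in>V. a v \<in> {1..N} \<and> d (a v) = j) \<and> poly_eval P (\<lambda>v. int (a v)) = 0)"
    using partition_regular_compactness[OF P(1,3) c] ..
  \<comment> \<open>The product colouring: lists of fixed length \<open>N\<close> over a finite
    palette, hence finitely many colours.\<close>
  define e where "e k = map (\<lambda>i. c (i * k)) [1..<Suc N]" for k
  have "e ` {1..} \<subseteq> {xs. set xs \<subseteq> c ` {1..} \<and> length xs = N}"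
    by (auto simp: e_def simp del: upt_Suc)
  then have "finite (e ` {1..})"
    using finite_lists_length_eq[OF c] finite_subset by blast
  then obtain b l where b: "\<forall>w\<in>W. b w \<ge> 1 \<and> e (b w) = l"
    and Q0: "poly_eval Q (\<lambda>w. int (b w)) = 0"
    by (rule partition_regular_colouring[OF Q(1)])
  obtain w0 where w0: "w0 \<in> W" using Q(3) by blast
  have same: "c (i * b w) = c (i * b w0)" if "w \<in> W" "i \<in> {1..N}" for w i
  proof -
    have "e (b w) = e (b w0)" using b that w0 by simp
    then show ?thesis using that(2) by (auto simp: e_def simp del: upt_Suc)
  qed
  \<comment> \<open>Since \<open>b w0\<close> is positive, this colouring of the multipliers uses
    the palette for which \<open>N\<close> was chosen.\<close>
  have "(\<lambda>i. c (i * b w0)) ` {1..} \<subseteq> c ` {1..}"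
    using b w0 by auto
  with N obtain a j where a: "\<forall>v\<in>V. a v \<in> {1..N} \<and> c (a v * b w0) = j"
    and P0: "poly_eval P (\<lambda>v. int (a v)) = 0"
    by metis
  obtain v0 where v0: "v0 \<in> V" using P(4) by blast
  show thesis
  \<comment> \<open>The two families share the product of \<open>a v0\<close> and
    \<open>b w0\<close>, of colour \<open>j\<close>; \<open>same\<close> carries this colour to
    every \<open>a v0 * b w\<close>.\<close>
  proof (rule that[of "\<lambda>v. b w0 * a v" j "\<lambda>w. a v0 * b w"])
    show "\<forall>v\<in>V. 1 \<le> b w0 * a v \<and> c (b w0 * a v) = j"
      using a b w0 by (auto simp: mult.commute Suc_le_eq)
    show "\<forall>w\<in>W. 1 \<le> a v0 * b w \<and> c (a v0 * b w) = j"
      using a b v0 same[of _ "a v0"] by (auto simp: Suc_le_eq)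
    show "poly_eval P (\<lambda>v. int (b w0 * a v)) = 0"
      using homogeneous_poly_eval_scale_eq_0[OF P(2) P0, of "int (b w0)"] by simp
    show "poly_eval Q (\<lambda>w. int (a v0 * b w)) = 0"
      using homogeneous_poly_eval_scale_eq_0[OF Q(2) Q0, of "int (a v0)"] by simp
  qed
qed

text \<open>Disjointness of \<open>V\<close> and \<open>W\<close> lets two roots of one colour be
  glued into a single assignment that annihilates both summands.\<close>

lemma partition_regular_add:
  fixes P Q :: "'v int_mpoly"
  assumes P: "partition_regular V P" "homogeneous P" "finite V" "V \<noteq> {}" "poly_vars P \<subseteq> V"
    and Q: "partition_regular W Q" "homogeneous Q" "W \<noteq> {}" "poly_vars Q \<subseteq> W"
    and disj: "V \<inter> W = {}"
  shows "partition_regular (V \<union> W) (P + Q)"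
  unfolding partition_regular_def
proof (intro allI impI)
  fix r :: nat and A :: "nat \<Rightarrow> nat set"
  assume cover: "(\<Union>j\<in>{1..r}. A j) = {1..}"
  then have "\<forall>k\<in>{1..}. \<exists>j. j \<in> {1..r} \<and> k \<in> A j" by blast
  \<comment> \<open>The classes may overlap, so a colouring comes from choosing one class for each
    number.\<close>
  from bchoice[OF this] obtain c
    where "\<forall>k\<in>{1..}. c k \<in> {1..r} \<and> k \<in> A (c k)" ..
  then have c: "c k \<in> {1..r}" "k \<in> A (c k)" if "k \<ge> 1" for k
    using that by simp_all
  have "c ` {1..} \<subseteq> {1..r}"
    by (rule image_subsetI, rule c(1), simp)
  then have "finite (c ` {1..})"
    using finite_subset by blast
  then obtain a b j where a: "\<forall>v\<in>V. a v \<ge> 1 \<and> c (a v) = j"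
    and b: "\<forall>w\<in>W. b w \<ge> 1 \<and> c (b w) = j"
    and 0: "poly_eval P (\<lambda>v. int (a v)) = 0" "poly_eval Q (\<lambda>w. int (b w)) = 0"
    by (rule common_colour_solutions[OF P(1-4) Q(1-3)])
  define z where "z v = (if v \<in> V then a v else b v)" for v
  \<comment> \<open>An actual value of colour \<open>j\<close> is what shows that \<open>j\<close>
    is the index of a class.\<close>
  obtain v0 where "v0 \<in> V" using P(4) by blast
  then have "j \<in> {1..r}"
    using a c(1)[of "a v0"] by auto
  moreover have "\<forall>v\<in>V \<union> W. z v \<in> A j"
  proof
    fix v assume "v \<in> V \<union> W"
    then have "z v \<ge> 1 \<and> c (z v) = j" using a b by (auto simp: z_def)
    then show "z v \<in> A j" using c(2)[of "z v"] by simp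
  qed
  moreover have "poly_eval P (\<lambda>v. int (z v)) = poly_eval P (\<lambda>v. int (a v))"
    by (rule poly_eval_cong) (use P(5) in \<open>auto simp: z_def\<close>)
  moreover have "poly_eval Q (\<lambda>v. int (z v)) = poly_eval Q (\<lambda>v. int (b v))"
    by (rule poly_eval_cong) (use Q(4) disj in \<open>auto simp: z_def\<close>)
  ultimately show "\<exists>j\<in>{1..r}. \<exists>a. (\<forall>v\<in>V \<union> W. a v \<in> A j) \<and>
      poly_eval (P + Q) (\<lambda>v. int (a v)) = 0"
    using 0 by (intro bexI[of _ j] exI[of _ z]) (simp_all add: poly_eval_add)
qed

theorem theorem3p9:
  fixes P Q :: "'v int_mpoly" and n m :: nat and x y :: "nat \<Rightarrow> 'v"
  assumes "n \<ge> 1" and "m \<ge> 1"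
    and "inj_on x {1..n}" and "inj_on y {1..m}"
    and "poly_vars P = x ` {1..n}" and "poly_vars Q = y ` {1..m}"
    and "homogeneous P" and "homogeneous Q"
    and "constant_term P = 0" and "constant_term Q = 0"
    and "partition_regular (x ` {1..n}) P" and "partition_regular (y ` {1..m}) Q"
    and "x ` {1..n} \<inter> y ` {1..m} = {}"
  shows "partition_regular (x ` {1..n} \<union> y ` {1..m}) (P + Q)"
proof (rule partition_regular_add[OF assms(11,7) _ _ _ assms(12,8) _ _ assms(13)])
  show "poly_vars P \<subseteq> x ` {1..n}" "poly_vars Q \<subseteq> y ` {1..m}"
    using assms(5,6) by simp_all
  show "finite (x ` {1..n})" "x ` {1..n} \<noteq> {}" "y ` {1..m} \<noteq> {}"
    using assms(1,2) by simp_all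
qed

end
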